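(* Let $C\in\mathcal{K}^n$ (full-dimensional). Then \[ \mathrm{conv}\left(\left\{\begin{pmatrix}0\\1\end{pmatrix},\begin{pmatrix}1\\1\end{pmatrix}\right\}\right)\subset f(\mathcal{K}^n,C), \] and equality holds if and only if $C$ is a parallelotope.
   Context: $\mathcal{K}^n$ denotes the set of convex bodies, i.e. (nonempty) convex compact subsets of $\mathbb{R}^n$; $\mathrm{conv}$ denotes the convex hull. For $K,C\in\mathcal{K}^n$, with $C$ full-dimensional (the gauge): the circumradius $R(K,C)$ is the smallest $\lambda\geq 0$ such that a translate of $K$ is contained in $\lambda C$; the inradius $r(K,C)$ is the largest $\lambda\geq 0$ such that a translate of $K$ contains $\lambda C$; the diameter is $D(K,C)=2\max_{x,y\in K}R(\{x,y\},C)$. For $K$ not a single point (so that $R(K,C)>0$), define \[ f(K,C)=\left(\frac{r(K,C)}{R(K,C)},\frac{D(K,C)}{2R(K,C)}\right)\in[0,1]^2 , \] and let $f(\mathcal{K}^n,C)$ be the set of all values $f(K,C)$ with $K\in\mathcal{K}^n$ not a single point. A parallelotope in $\mathbb{R}^n$ is a full-dimensional set that is the image of the cube $[-1,1]^n$ under an invertible affine map.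
   Formalization: The dimension is assumed to be n ≥ 2; for n = 1 every K that is not a point is a translate of a dilate of C, so f(K^1,C) = {(1,1)} and the stated inclusion fails. *)

theory Defs
  imports "HOL-Analysis.Analysis"
begin

definition convex_body :: "(real ^ 'n) set \<Rightarrow> bool" where
  "convex_body K \<longleftrightarrow> convex K \<and> compact K \<and> K \<noteq> {}"

definition full_dimensional :: "(real ^ 'n) set \<Rightarrow> bool" where
  "full_dimensional C \<longleftrightarrow> aff_dim C = int CARD('n)"

text \<open>
  The extrema below are attained when \<open>C\<close> is a full-dimensional convex body and \<open>K\<close> is compact and
  nonempty; outside that range the values are irrelevant. The circumradius is also applied to
  two-point sets, so \<open>K\<close> is an arbitrary set in these definitions.
\<close>

definition circumradius :: "(real ^ 'n) set \<Rightarrow> (real ^ 'n) set \<Rightarrow> real" where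
  "circumradius K C =
    (LEAST l. 0 \<le> l \<and> (\<exists>t. (\<lambda>x. t + x) ` K \<subseteq> (\<lambda>x. l *\<^sub>R x) ` C))"

definition inradius :: "(real ^ 'n) set \<Rightarrow> (real ^ 'n) set \<Rightarrow> real" where
  "inradius K C =
    (GREATEST l. 0 \<le> l \<and> (\<exists>t. (\<lambda>x. l *\<^sub>R x) ` C \<subseteq> (\<lambda>x. t + x) ` K))"

definition gauge_diameter :: "(real ^ 'n) set \<Rightarrow> (real ^ 'n) set \<Rightarrow> real" where
  "gauge_diameter K C =
    2 * (GREATEST d. \<exists>x\<in>K. \<exists>y\<in>K. d = circumradius {x, y} C)"

definition radii_ratios :: "(real ^ 'n) set \<Rightarrow> (real ^ 'n) set \<Rightarrow> real \<times> real" where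
  "radii_ratios K C =
    (inradius K C / circumradius K C, gauge_diameter K C / (2 * circumradius K C))"

definition radii_diagram :: "(real ^ 'n) set \<Rightarrow> (real \<times> real) set" where
  "radii_diagram C = {radii_ratios K C | K. convex_body K \<and> \<not> (\<exists>p. K = {p})}"

definition parallelotope :: "(real ^ 'n) set \<Rightarrow> bool" where
  "parallelotope P \<longleftrightarrow>
    (\<exists>(A :: real ^ 'n ^ 'n) t. invertible A \<and> P = (\<lambda>x. A *v x + t) ` cbox (- 1) 1)"

end

theory Submission
  imports Defs
begin

text \<open>
  Let \<open>B = C - C\<close> be the difference body. Two points fit into a translate of the \<open>l\<close>-fold gauge exactly if
  their difference lies in \<open>l B\<close> (\<open>circumradius_pair_le_iff\<close>), so half the diameter of \<open>K\<close> is its diameter in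
  the norm with unit ball \<open>B\<close>.

  \<^emph>\<open>The segment is always attained.\<close> Interpolating between a diametral segment of \<open>C\<close> and \<open>C\<close> itself keeps
  diameter and circumradius constant, and moves the inradius linearly from \<open>0\<close> to \<open>1\<close>
  (\<open>segment_point_realized\<close>).

  \<^emph>\<open>Parallelotopes.\<close> Their norm is a maximum norm, for which every body is contained in a ball of half its
  diameter (\<open>parallelotope_circumradius_le\<close>); thus the second coordinate is always \<open>1\<close>.

  \<^emph>\<open>Conversely\<close>, if the second coordinate is always \<open>1\<close>, then \<open>C\<close> has an intersection property of Helly type: a body
  all of whose differences lie in \<open>B\<close> can be translated into \<open>C\<close> (\<open>translate_into_gauge\<close>). For \<open>- C\<close> this shows that
  \<open>C\<close> is centrally symmetric. Next, consider normals of \<open>C\<close> at points where a ball inside \<open>C\<close> touches the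
  boundary. These half-spaces cut out \<open>C\<close> (\<open>touching_ball_separates\<close>), and near such a point \<open>C\<close> looks like
  a half-space. Half-spaces with pairwise non-opposite normals intersect in pairs; but if a
  positive combination of the normals vanishes and the half-spaces are moved back from a
  common boundary point, they have no point in common. Turned into a statement about small
  perturbations of contact points, this contradicts the intersection property
  (\<open>no_positive_circuit\<close>). Since the signs of the normals may be changed, linear relations between them
  are excluded as well, apart from proportionality. Hence all normals are multiples of the elements of
  one basis, and \<open>C\<close> is an intersection of as many independent slabs as the dimension.
\<close>

section \<open>Attainment of the radii\<close>

lemma full_dimensional_interior:
  fixes C :: "(real ^ 'n) set"
  assumes "convex_body C" and "full_dimensional C"
  obtains c r where "0 < r" and "cball c r \<subseteq> C"
proof -
  have cv: "convex C" and ne: "C \<noteq> {}"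
    using assms(1) by (auto simp: convex_body_def)
  have "aff_dim C = int DIM(real ^ 'n)"
    using assms(2) by (simp add: full_dimensional_def)
  then have "affine hull C = UNIV"
    using aff_dim_eq_full[of C] by simp
  then have "interior C \<noteq> {}"
    using rel_interior_interior[of C] rel_interior_eq_empty[OF cv] ne by auto
  then obtain c where "c \<in> interior C" by auto
  then show thesis
    using that by (auto simp: mem_interior_cball)
qed

text \<open>
  The difference body of a convex set is star-shaped about the origin, so enlarging the factor
  does not lose any difference.
\<close>

lemma scaled_difference_mono:
  fixes C :: "(real ^ 'n) set"
  assumes "convex C" and "0 \<le> k" and "k \<le> l" and "a \<in> C" and "b \<in> C"
  shows "\<exists>a'\<in>C. \<exists>b'\<in>C. k *\<^sub>R (a - b) = l *\<^sub>R (a' - b')"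
proof (cases "l = 0")
  case True
  then show ?thesis using assms by auto
next
  case False
  define s where "s = k / l"
  have s: "0 \<le> s" "s \<le> 1" "k = l * s"
    using assms False by (auto simp: s_def)
  have "(1 - s) *\<^sub>R b + s *\<^sub>R a \<in> C"
    using convexD_alt[OF assms(1,5,4)] s by simp
  moreover have "k *\<^sub>R (a - b) = l *\<^sub>R (((1 - s) *\<^sub>R b + s *\<^sub>R a) - b)"
    using s by (simp add: algebra_simps)
  ultimately show ?thesis using assms by blast
qed

lemma scaled_difference_add:
  fixes C :: "(real ^ 'n) set"
  assumes "convex C" and "0 \<le> k" and "0 \<le> l"
    and "a \<in> C" and "b \<in> C" and "c \<in> C" and "d \<in> C"
  shows "\<exists>e\<in>C. \<exists>f\<in>C. k *\<^sub>R (a - b) + l *\<^sub>R (c - d) = (k + l) *\<^sub>R (e - f)"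
proof (cases "k + l = 0")
  case True
  then have "k = 0" "l = 0" using assms(2,3) by auto
  then show ?thesis using assms(4,5) by auto
next
  case False
  define s where "s = l / (k + l)"
  have s: "0 \<le> s" "s \<le> 1" and l: "l = (k + l) * s" and k: "k = (k + l) * (1 - s)"
    using assms False by (auto simp: s_def field_simps)
  have "k *\<^sub>R (a - b) + l *\<^sub>R (c - d)
      = ((k + l) * (1 - s)) *\<^sub>R (a - b) + ((k + l) * s) *\<^sub>R (c - d)"
    using k l by simp
  also have "\<dots> = (k + l) *\<^sub>R (((1 - s) *\<^sub>R a + s *\<^sub>R c) - ((1 - s) *\<^sub>R b + s *\<^sub>R d))"
    by (simp add: algebra_simps)
  finally show ?thesis
    using convexD_alt[OF assms(1,4,6) s] convexD_alt[OF assms(1,5,7) s] by blast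
qed

text \<open>
  A ball inside the gauge, scaled until its radius bounds the norms in \<open>K\<close>, already
  covers \<open>K\<close> up to translation. Hence the set of admissible factors is inhabited.
\<close>

lemma exists_circumscribed_homothet:
  fixes C :: "(real ^ 'n) set"
  assumes "0 < r" and "cball c r \<subseteq> C" and "compact K"
  shows "\<exists>l t. 0 \<le> l \<and> (\<lambda>x. t + x) ` K \<subseteq> (\<lambda>x. l *\<^sub>R x) ` C"
proof -
  obtain B where B: "0 < B" "\<And>x. x \<in> K \<Longrightarrow> norm x \<le> B"
    using compact_imp_bounded[OF assms(3)] by (auto simp: bounded_pos)
  define l where "l = B / r"
  have l: "0 < l" using B assms by (simp add: l_def)
  have "l *\<^sub>R c + x \<in> (\<lambda>x. l *\<^sub>R x) ` C" if "x \<in> K" for x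
  proof -
    have "norm x / l \<le> r"
      using B(2)[OF that] B(1) assms(1) by (simp add: l_def field_simps)
    then have "c + (1 / l) *\<^sub>R x \<in> cball c r"
      using l by (simp add: dist_norm)
    then have "c + (1 / l) *\<^sub>R x \<in> C" using assms(2) by auto
    moreover have "l *\<^sub>R c + x = l *\<^sub>R (c + (1 / l) *\<^sub>R x)"
      using l by (simp add: algebra_simps)
    ultimately show ?thesis by blast
  qed
  then show ?thesis using l by (intro exI[of _ l] exI[of _ "l *\<^sub>R c"]) auto
qed

text \<open>
  Existence of the minimum is a compactness argument on pairs of a factor and a translation.
  For a fixed point \<open>x\<close> of \<open>K\<close>, the pairs \<open>(l, t)\<close> with \<open>t + x\<close> in the \<open>l\<close>-fold gauge are the continuous image of
  \<open>(l, c) \<mapsto> (l, l c - x)\<close>; parametrising by the point \<open>c\<close> of the gauge avoids a division by \<open>l\<close>,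
  which may vanish.
\<close>

lemma circumradius_is_least:
  fixes C :: "(real ^ 'n) set"
  assumes "convex_body C" and "full_dimensional C" and "compact K" and "K \<noteq> {}"
  shows "0 \<le> circumradius K C \<and>
      (\<exists>t. (\<lambda>x. t + x) ` K \<subseteq> (\<lambda>x. circumradius K C *\<^sub>R x) ` C) \<and>
      (\<forall>l t. 0 \<le> l \<longrightarrow> (\<lambda>x. t + x) ` K \<subseteq> (\<lambda>x. l *\<^sub>R x) ` C \<longrightarrow> circumradius K C \<le> l)"
proof -
  define P where "P l \<longleftrightarrow> 0 \<le> l \<and> (\<exists>t. (\<lambda>x. t + x) ` K \<subseteq> (\<lambda>x. l *\<^sub>R x) ` C)" for l
  have cC: "compact C" using assms by (simp add: convex_body_def)
  obtain c r where "0 < r" "cball c r \<subseteq> C"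
    using full_dimensional_interior assms by blast
  then obtain l0 where l0: "P l0"
    using exists_circumscribed_homothet[OF _ _ assms(3)] unfolding P_def by blast
  define h where "h x = (\<lambda>p :: real \<times> (real ^ 'n). (fst p, fst p *\<^sub>R snd p - x))" for x :: "real ^ 'n"
  define T where "T = (\<Inter>x\<in>K. h x ` ({0..l0} \<times> C))"
  have T: "(l, t) \<in> T \<longleftrightarrow> 0 \<le> l \<and> l \<le> l0 \<and> (\<lambda>x. t + x) ` K \<subseteq> (\<lambda>x. l *\<^sub>R x) ` C" for l t
  proof -
    have "(l, t) \<in> h x ` ({0..l0} \<times> C) \<longleftrightarrow> 0 \<le> l \<and> l \<le> l0 \<and> t + x \<in> (\<lambda>x. l *\<^sub>R x) ` C" for x
    proof -
      have "(l, t) = h x p \<longleftrightarrow> l = fst p \<and> t + x = fst p *\<^sub>R snd p" for p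
        by (simp add: h_def eq_diff_eq)
      then show ?thesis by (auto simp: image_iff)
    qed
    then show ?thesis using assms(4) by (auto simp: T_def)
  qed
  have "compact (h x ` ({0..l0} \<times> C))" for x
    unfolding h_def
    by (intro compact_continuous_image compact_Times cC compact_Icc continuous_intros)
  then have "compact T"
    unfolding T_def using assms(4) by (intro compact_Inter) auto
  then have "compact (fst ` T)"
    by (intro compact_continuous_image continuous_intros)
  moreover have "fst ` T \<noteq> {}"
    using l0 T[of l0] by (auto simp: P_def)
  ultimately obtain l where l: "l \<in> fst ` T" "\<And>k. k \<in> fst ` T \<Longrightarrow> l \<le> k"
    using compact_attains_inf[of "fst ` T"] by blast
  have Pl: "P l" using l(1) T by (force simp: P_def)
  have le: "l \<le> k" if "P k" for k
  proof (cases "k \<le> l0")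
    case True
    with that obtain t where "(k, t) \<in> T" using T by (auto simp: P_def)
    then show ?thesis using l(2) by force
  next
    case False
    moreover have "l \<le> l0" using l(1) T by force
    ultimately show ?thesis by simp
  qed
  have "circumradius K C = l"
    unfolding circumradius_def P_def[symmetric]
    using Pl le by (rule Least_equality)
  then show ?thesis using Pl le by (auto simp: P_def)
qed

lemmas circumradius_nonneg = circumradius_is_least[THEN conjunct1]
lemmas circumradius_attained = circumradius_is_least[THEN conjunct2, THEN conjunct1]
lemmas circumradius_le = circumradius_is_least[THEN conjunct2, THEN conjunct2, rule_format]

lemma circumradius_mono:
  fixes C :: "(real ^ 'n) set"
  assumes "convex_body C" and "full_dimensional C"
    and "compact L" and "compact K" and "L \<subseteq> K" and "L \<noteq> {}"
  shows "circumradius L C \<le> circumradius K C"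
proof -
  have "K \<noteq> {}" using assms by auto
  then obtain t where "(\<lambda>x. t + x) ` K \<subseteq> (\<lambda>x. circumradius K C *\<^sub>R x) ` C"
    using circumradius_attained assms by blast
  then have "(\<lambda>x. t + x) ` L \<subseteq> (\<lambda>x. circumradius K C *\<^sub>R x) ` C"
    using assms by auto
  then show ?thesis
    using circumradius_le circumradius_nonneg assms \<open>K \<noteq> {}\<close> by metis
qed

text \<open>
  The circumradius of a pair of points is their distance in the norm whose unit ball is the
  difference body of the gauge. This reduces all statements about the diameter to differences of
  points of \<open>C\<close>.
\<close>

lemma circumradius_pair_le_iff:
  fixes C :: "(real ^ 'n) set"
  assumes "convex_body C" and "full_dimensional C" and "0 \<le> l"
  shows "circumradius {x, y} C \<le> l \<longleftrightarrow> (\<exists>a\<in>C. \<exists>b\<in>C. x - y = l *\<^sub>R (a - b))"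
proof
  assume le: "circumradius {x, y} C \<le> l"
  let ?R = "circumradius {x, y} C"
  obtain t where "(\<lambda>x. t + x) ` {x, y} \<subseteq> (\<lambda>x. ?R *\<^sub>R x) ` C"
    using circumradius_attained[OF assms(1,2), of "{x, y}"] by auto
  then obtain a b where ab: "a \<in> C" "b \<in> C" "t + x = ?R *\<^sub>R a" "t + y = ?R *\<^sub>R b"
    by auto
  have "x - y = ?R *\<^sub>R (a - b)"
    using ab(3,4) by (metis add_diff_cancel_left scaleR_diff_right)
  moreover have "0 \<le> ?R" using circumradius_nonneg[OF assms(1,2), of "{x, y}"] by simp
  moreover have "convex C" using assms by (simp add: convex_body_def)
  ultimately show "\<exists>a\<in>C. \<exists>b\<in>C. x - y = l *\<^sub>R (a - b)"
    using scaled_difference_mono[OF _ _ le ab(1,2)] by simp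
next
  assume "\<exists>a\<in>C. \<exists>b\<in>C. x - y = l *\<^sub>R (a - b)"
  then obtain a b where ab: "a \<in> C" "b \<in> C" "x - y = l *\<^sub>R (a - b)" by auto
  have "(l *\<^sub>R b - y) + x = l *\<^sub>R a"
    using ab(3) by (simp add: algebra_simps)
  then have "(\<lambda>z. (l *\<^sub>R b - y) + z) ` {x, y} \<subseteq> (\<lambda>z. l *\<^sub>R z) ` C"
    using ab by auto
  then show "circumradius {x, y} C \<le> l"
    by (intro circumradius_le[OF assms(1,2) _ _ assms(3)]) auto
qed

lemma circumradius_pair_translate:
  "circumradius {x, y} C = circumradius {x - y, 0} C"
proof -
  have "(\<exists>t. (\<lambda>z. t + z) ` {x, y} \<subseteq> S) \<longleftrightarrow> (\<exists>t. (\<lambda>z. t + z) ` {x - y, 0} \<subseteq> S)" for S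
  proof
    assume "\<exists>t. (\<lambda>z. t + z) ` {x, y} \<subseteq> S"
    then obtain t where "t + x \<in> S" "t + y \<in> S" by auto
    then show "\<exists>t. (\<lambda>z. t + z) ` {x - y, 0} \<subseteq> S"
      by (intro exI[of _ "t + y"]) (auto simp: algebra_simps)
  next
    assume "\<exists>t. (\<lambda>z. t + z) ` {x - y, 0} \<subseteq> S"
    then obtain t where "t + (x - y) \<in> S" "t \<in> S" by auto
    then show "\<exists>t. (\<lambda>z. t + z) ` {x, y} \<subseteq> S"
      by (intro exI[of _ "t - y"]) (auto simp: algebra_simps)
  qed
  then show ?thesis unfolding circumradius_def by presburger
qed

text \<open>
  A ball of radius \<open>r\<close> in the gauge bounds the norm of the difference body by \<open>1 / r\<close> times the
  Euclidean norm; with the triangle inequality this gives a Lipschitz bound, and thereby the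
  attainment of the diameter.
\<close>

lemma continuous_circumradius_pair:
  fixes C :: "(real ^ 'n) set"
  assumes "convex_body C" and "full_dimensional C"
  shows "continuous_on S (\<lambda>z. circumradius {z, 0} C)"
proof -
  let ?g = "\<lambda>z. circumradius {z, 0} C"
  obtain c r where r: "0 < r" and cb: "cball c r \<subseteq> C"
    using full_dimensional_interior assms by blast
  have cv: "convex C" using assms by (simp add: convex_body_def)
  have nn: "0 \<le> ?g z" for z using circumradius_nonneg[OF assms, of "{z, 0}"] by simp
  have lip: "?g z \<le> ?g w + norm (z - w) / r" for z w
  proof -
    obtain a b where ab: "a \<in> C" "b \<in> C" "w = ?g w *\<^sub>R (a - b)"
      using circumradius_pair_le_iff[OF assms nn, of w 0 w] by auto
    define k where "k = norm (z - w) / r"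
    have k: "0 \<le> k" using r by (simp add: k_def)
    define d where "d = c + (r / norm (z - w)) *\<^sub>R (z - w)"
    have "d \<in> cball c r" using r by (simp add: d_def dist_norm)
    moreover have "c \<in> cball c r" using r by simp
    ultimately have dc: "d \<in> C" "c \<in> C" using cb by auto
    have "z - w = k *\<^sub>R (d - c)"
      using r by (simp add: k_def d_def)
    then have "z - 0 = ?g w *\<^sub>R (a - b) + k *\<^sub>R (d - c)"
      using ab(3) by (metis diff_zero diff_add_cancel add.commute)
    then have "\<exists>a\<in>C. \<exists>b\<in>C. z - 0 = (?g w + k) *\<^sub>R (a - b)"
      using scaled_difference_add[OF cv nn k ab(1,2) dc] by simp
    then show ?thesis
      using circumradius_pair_le_iff[OF assms, of "?g w + k" z 0] nn[of w] k by (simp add: k_def)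
  qed
  have "dist (?g z) (?g w) \<le> (1 / r) * dist z w" for z w
    using lip[of z w] lip[of w z] by (simp add: dist_norm norm_minus_commute abs_le_iff)
  then have "(1 / r)-lipschitz_on S ?g"
    using r by (intro lipschitz_onI) auto
  then show ?thesis by (rule lipschitz_on_continuous_on)
qed

lemma gauge_diameter_is_greatest:
  fixes C :: "(real ^ 'n) set"
  assumes "convex_body C" and "full_dimensional C" and "compact K" and "K \<noteq> {}"
  shows "(\<exists>x\<in>K. \<exists>y\<in>K. gauge_diameter K C = 2 * circumradius {x, y} C) \<and>
      (\<forall>x\<in>K. \<forall>y\<in>K. 2 * circumradius {x, y} C \<le> gauge_diameter K C)"
proof -
  let ?g = "\<lambda>z. circumradius {z, 0} C"
  define S where "S = {x - y | x y. x \<in> K \<and> y \<in> K}"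
  have "compact S" unfolding S_def by (rule compact_differences[OF assms(3,3)])
  moreover have "S \<noteq> {}" using assms(4) by (auto simp: S_def)
  ultimately obtain z where z: "z \<in> S" "\<And>w. w \<in> S \<Longrightarrow> ?g w \<le> ?g z"
    using continuous_attains_sup[OF _ _ continuous_circumradius_pair[OF assms(1,2), of S]] by metis
  then obtain x y where xy: "x \<in> K" "y \<in> K" "z = x - y" by (auto simp: S_def)
  have g: "circumradius {x', y'} C = ?g (x' - y')" for x' y'
    by (rule circumradius_pair_translate)
  have ub: "circumradius {x', y'} C \<le> circumradius {x, y} C" if "x' \<in> K" "y' \<in> K" for x' y'
  proof -
    have "x' - y' \<in> S" using that by (auto simp: S_def)
    then show ?thesis using z(2) xy(3) g[of x' y'] g[of x y] by simp
  qed
  have "(GREATEST d. \<exists>x\<in>K. \<exists>y\<in>K. d = circumradius {x, y} C) = circumradius {x, y} C"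
    using xy ub by (intro Greatest_equality) auto
  then show ?thesis
    using xy ub by (auto simp: gauge_diameter_def)
qed

lemmas gauge_diameter_attained = gauge_diameter_is_greatest[THEN conjunct1]
lemmas gauge_diameter_ge = gauge_diameter_is_greatest[THEN conjunct2, rule_format]

lemma gauge_diameter_le:
  fixes C :: "(real ^ 'n) set"
  assumes "convex_body C" and "full_dimensional C" and "compact K" and "K \<noteq> {}"
  shows "gauge_diameter K C \<le> 2 * circumradius K C"
proof -
  obtain x y where "x \<in> K" "y \<in> K" and D: "gauge_diameter K C = 2 * circumradius {x, y} C"
    using gauge_diameter_attained[OF assms] by auto
  then show ?thesis
    using circumradius_mono[OF assms(1,2) _ assms(3), of "{x, y}"] by simp
qed

text \<open>
  A circumradius of zero would place \<open>K\<close> in a translate of a single point.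
\<close>

lemma circumradius_pos:
  fixes C :: "(real ^ 'n) set"
  assumes "convex_body C" and "full_dimensional C" and "compact K" and "x \<in> K" and "y \<in> K" and "x \<noteq> y"
  shows "0 < circumradius K C"
proof -
  have K: "K \<noteq> {}" using assms by auto
  obtain t where t: "(\<lambda>x. t + x) ` K \<subseteq> (\<lambda>x. circumradius K C *\<^sub>R x) ` C"
    using circumradius_attained[OF assms(1-3) K] by auto
  have "circumradius K C \<noteq> 0"
  proof
    assume "circumradius K C = 0"
    with t have "t + x = 0" "t + y = 0" using assms(4,5) by auto
    then show False using assms(6) by (metis add_left_cancel)
  qed
  then show ?thesis using circumradius_nonneg[OF assms(1-3) K] by simp
qed

text \<open>
  A width comparison: if, seen through the functional \<open>u\<close>, an \<open>l\<close>-fold gauge fits into an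
  \<open>m\<close>-fold one, then \<open>l \<le> m\<close>. The containment is only required for the values of \<open>u\<close>, because
  it is applied to a body that exceeds a homothet of \<open>C\<close> in directions orthogonal to \<open>u\<close>.
\<close>

lemma homothet_ratio_le:
  fixes C :: "(real ^ 'n) set"
  assumes "a \<in> C" and "b \<in> C" and "u \<bullet> b < u \<bullet> a"
    and "\<And>x. x \<in> C \<Longrightarrow> u \<bullet> b \<le> u \<bullet> x \<and> u \<bullet> x \<le> u \<bullet> a"
    and "\<And>x. x \<in> C \<Longrightarrow> \<exists>y\<in>C. u \<bullet> (l *\<^sub>R x) = k + m * (u \<bullet> y)" and "0 \<le> m"
  shows "l \<le> m"
proof -
  obtain y where y: "y \<in> C" "u \<bullet> (l *\<^sub>R a) = k + m * (u \<bullet> y)" using assms(5)[OF assms(1)] by auto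
  obtain z where z: "z \<in> C" "u \<bullet> (l *\<^sub>R b) = k + m * (u \<bullet> z)" using assms(5)[OF assms(2)] by auto
  have "l * (u \<bullet> a - u \<bullet> b) = m * (u \<bullet> y - u \<bullet> z)"
    using y z by (simp add: algebra_simps)
  also have "\<dots> \<le> m * (u \<bullet> a - u \<bullet> b)"
    using assms(4)[OF y(1)] assms(4)[OF z(1)] assms(6) by (intro mult_left_mono) auto
  finally show ?thesis using assms(3) by simp
qed

text \<open>
  Full-dimensionality enters most estimates through this fact: every nonzero linear functional
  is non-constant on the gauge, so it can compare sizes of homothets.
\<close>

lemma full_dimensional_width:
  fixes C :: "(real ^ 'n) set"
  assumes "convex_body C" and "full_dimensional C" and "u \<noteq> 0"
  obtains a b where "a \<in> C" and "b \<in> C" and "u \<bullet> b < u \<bullet> a"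
    and "\<And>x. x \<in> C \<Longrightarrow> u \<bullet> b \<le> u \<bullet> x \<and> u \<bullet> x \<le> u \<bullet> a"
proof -
  have C: "compact C" "C \<noteq> {}" using assms by (auto simp: convex_body_def)
  have cont: "continuous_on C (\<lambda>x. u \<bullet> x)" by (intro continuous_intros)
  obtain a where a: "a \<in> C" "\<And>x. x \<in> C \<Longrightarrow> u \<bullet> x \<le> u \<bullet> a"
    using continuous_attains_sup[OF C cont] by blast
  obtain b where b: "b \<in> C" "\<And>x. x \<in> C \<Longrightarrow> u \<bullet> b \<le> u \<bullet> x"
    using continuous_attains_inf[OF C cont] by blast
  obtain c r where r: "0 < r" and cb: "cball c r \<subseteq> C"
    using full_dimensional_interior assms by blast
  have "c + (r / norm u) *\<^sub>R u \<in> cball c r" "c \<in> cball c r"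
    using r by (auto simp: dist_norm)
  then have "c + (r / norm u) *\<^sub>R u \<in> C" "c \<in> C" using cb by auto
  then have "u \<bullet> (c + (r / norm u) *\<^sub>R u) \<le> u \<bullet> a" "u \<bullet> b \<le> u \<bullet> c" using a b by auto
  moreover have "0 < (r / norm u) * (u \<bullet> u)" using r assms(3) by simp
  ultimately have "u \<bullet> b < u \<bullet> a" by (simp add: inner_add_right)
  then show thesis using that a b by blast
qed

text \<open>
  Every admissible inner factor is at most the circumradius, since a homothet of the gauge inside
  another one cannot be larger. That bound also confines the pairs of a factor and a translation
  to a compact set, which yields the maximum.
\<close>

lemma inradius_properties:
  fixes C :: "(real ^ 'n) set"
  assumes "convex_body C" and "full_dimensional C" and "compact K" and "K \<noteq> {}"
  shows "0 \<le> inradius K C \<and>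
      (\<exists>t. (\<lambda>x. inradius K C *\<^sub>R x) ` C \<subseteq> (\<lambda>x. t + x) ` K) \<and>
      inradius K C \<le> circumradius K C"
proof -
  define P where "P l \<longleftrightarrow> 0 \<le> l \<and> (\<exists>t. (\<lambda>x. l *\<^sub>R x) ` C \<subseteq> (\<lambda>x. t + x) ` K)" for l
  let ?R = "circumradius K C"
  have cC: "compact C" "C \<noteq> {}" using assms by (auto simp: convex_body_def)
  then obtain c0 where c0: "c0 \<in> C" by auto
  have bound: "l \<le> ?R" if Pl: "P l" for l
  proof -
    obtain t where t: "(\<lambda>x. l *\<^sub>R x) ` C \<subseteq> (\<lambda>x. t + x) ` K"
      using Pl by (auto simp: P_def)
    obtain s where s: "(\<lambda>x. s + x) ` K \<subseteq> (\<lambda>x. ?R *\<^sub>R x) ` C"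
      using circumradius_attained[OF assms] by auto
    obtain u :: "real ^ 'n" where "u \<noteq> 0" using vector_choose_size[of 1] by fastforce
    then obtain a b where ab: "a \<in> C" "b \<in> C" "u \<bullet> b < u \<bullet> a"
      "\<And>x. x \<in> C \<Longrightarrow> u \<bullet> b \<le> u \<bullet> x \<and> u \<bullet> x \<le> u \<bullet> a"
      using full_dimensional_width[OF assms(1,2)] by blast
    have "\<exists>y\<in>C. u \<bullet> (l *\<^sub>R x) = u \<bullet> (t - s) + ?R * (u \<bullet> y)" if "x \<in> C" for x
    proof -
      have "l *\<^sub>R x \<in> (\<lambda>x. t + x) ` K" using t that by blast
      then obtain k where k: "k \<in> K" "l *\<^sub>R x = t + k" by (rule imageE) simp
      have "s + k \<in> (\<lambda>x. ?R *\<^sub>R x) ` C" using s k(1) by blast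
      then obtain y where "y \<in> C" "s + k = ?R *\<^sub>R y" by (rule imageE) simp
      moreover from this have "l *\<^sub>R x = (t - s) + ?R *\<^sub>R y" using k(2) by (simp add: algebra_simps)
      ultimately show ?thesis by (metis inner_add_right inner_scaleR_right)
    qed
    then show "l \<le> ?R"
      using homothet_ratio_le[OF ab, of l] circumradius_nonneg[OF assms] by blast
  qed
  define h where "h = (\<lambda>p :: real \<times> (real ^ 'n). (fst p, fst p *\<^sub>R c0 - snd p))"
  define T where "T = h ` ({0..?R} \<times> K) \<inter> (\<Inter>c\<in>C. {p. fst p *\<^sub>R c - snd p \<in> K})"
  have T: "(l, t) \<in> T \<longleftrightarrow> 0 \<le> l \<and> l \<le> ?R \<and> (\<lambda>x. l *\<^sub>R x) ` C \<subseteq> (\<lambda>x. t + x) ` K" for l t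
  proof -
    have "(\<lambda>x. l *\<^sub>R x) ` C \<subseteq> (\<lambda>x. t + x) ` K \<longleftrightarrow> (\<forall>c\<in>C. l *\<^sub>R c - t \<in> K)"
    proof -
      have "z \<in> (\<lambda>x. t + x) ` K \<longleftrightarrow> z - t \<in> K" for z
        by (metis (no_types, lifting) add_diff_cancel_left' diff_add_cancel add.commute image_iff)
      then show ?thesis by (simp add: image_subset_iff)
    qed
    moreover have "(l, t) \<in> h ` ({0..?R} \<times> K) \<longleftrightarrow> 0 \<le> l \<and> l \<le> ?R \<and> l *\<^sub>R c0 - t \<in> K"
    proof -
      have "(l, t) = h p \<longleftrightarrow> l = fst p \<and> snd p = l *\<^sub>R c0 - t" for p
        by (auto simp: h_def)
      then show ?thesis by (auto simp: image_iff)
    qed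
    ultimately show ?thesis using c0 by (auto simp: T_def)
  qed
  have "compact (h ` ({0..?R} \<times> K))"
    unfolding h_def
    by (intro compact_continuous_image compact_Times assms(3) compact_Icc continuous_intros)
  moreover have "closed (\<Inter>c\<in>C. {p :: real \<times> (real ^ 'n). fst p *\<^sub>R c - snd p \<in> K})"
  proof (intro closed_INT ballI)
    fix c :: "real ^ 'n"
    have "closed ((\<lambda>p :: real \<times> (real ^ 'n). fst p *\<^sub>R c - snd p) -` K)"
      by (intro closed_vimage compact_imp_closed assms(3) continuous_intros)
    then show "closed {p :: real \<times> (real ^ 'n). fst p *\<^sub>R c - snd p \<in> K}"
      by (simp add: vimage_def)
  qed
  ultimately have "compact T" unfolding T_def by (rule compact_Int_closed)
  then have "compact (fst ` T)"
    by (intro compact_continuous_image continuous_intros)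
  moreover obtain k0 where "k0 \<in> K" using assms(4) by auto
  then have "(0, - k0) \<in> T"
    unfolding T using circumradius_nonneg[OF assms] by force
  then have "fst ` T \<noteq> {}" by auto
  ultimately obtain l where l: "l \<in> fst ` T" "\<And>k. k \<in> fst ` T \<Longrightarrow> k \<le> l"
    using compact_attains_sup[of "fst ` T"] by blast
  have Pl: "P l" using l(1) T by (force simp: P_def)
  have ge: "k \<le> l" if Pk: "P k" for k
  proof -
    obtain t where "(k, t) \<in> T" using Pk bound[OF Pk] T by (auto simp: P_def)
    then show ?thesis using l(2) by force
  qed
  have "inradius K C = l"
    unfolding inradius_def P_def[symmetric]
    using Pl ge by (rule Greatest_equality)
  then show ?thesis using Pl bound[OF Pl] by (auto simp: P_def)
qed

section \<open>The segment lies in every diagram\<close>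

lemma unit_segment_hull:
  "convex hull {(0, 1), (1, 1)} = {0..1 :: real} \<times> {1 :: real}"
proof -
  have "p \<in> closed_segment (0, 1) (1, 1) \<longleftrightarrow> p \<in> {0..1} \<times> {1 :: real}" for p :: "real \<times> real"
    by (cases p) (auto simp: in_segment)
  then show ?thesis unfolding segment_convex_hull by (rule set_eqI)
qed

lemma exists_orthogonal_direction:
  fixes v :: "real ^ 'n"
  assumes "CARD('n) \<ge> 2"
  obtains u :: "real ^ 'n" where "u \<noteq> 0" and "u \<bullet> v = 0"
proof -
  have "dim {v} < DIM(real ^ 'n)"
    using dim_le_card[of "{v}" "{v}"] span_superset[of "{v}"] assms by simp
  then show thesis
    using orthogonal_to_subspace_exists[of "{v}"] that
    by (metis insertI1 orthogonal_def span_base)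
qed

text \<open>
  The body is \<open>K = (1 - s) [x, y] + s C\<close>, where \<open>[x, y]\<close> is a diametral segment of \<open>C\<close>. It lies
  between the segment and \<open>C\<close>, which have the same diameter and the same circumradius, so these two
  quantities of \<open>K\<close> agree with them. Its inradius is at least \<open>s\<close> by construction, and at most \<open>s\<close>
  because in a direction orthogonal to \<open>y - x\<close> the segment has no width. Such a direction
  exists in dimension at least two.
\<close>

lemma segment_point_realized:
  fixes C :: "(real ^ 'n) set"
  assumes n: "CARD('n) \<ge> 2" and C: "convex_body C" and fd: "full_dimensional C"
    and s: "0 \<le> s" "s \<le> 1"
  shows "(s, 1) \<in> radii_diagram C"
proof -
  have cvC: "convex C" and cC: "compact C" and neC: "C \<noteq> {}"
    using C by (auto simp: convex_body_def)
  obtain x y where xy: "x \<in> C" "y \<in> C" and D: "gauge_diameter C C = 2 * circumradius {x, y} C"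
    using gauge_diameter_attained[OF C fd cC neC] by blast
  obtain e :: "real ^ 'n" where e: "e \<noteq> 0" using vector_choose_size[of 1] by fastforce
  define d where "d = circumradius {x, y} C"
  have d_ge: "circumradius {x', y'} C \<le> d" if "x' \<in> C" "y' \<in> C" for x' y'
    using gauge_diameter_ge[OF C fd cC neC that] D by (simp add: d_def)
  have d0: "0 \<le> d" unfolding d_def using circumradius_nonneg[OF C fd, of "{x, y}"] by simp
  have d1: "d \<le> 1"
    unfolding d_def using circumradius_pair_le_iff[OF C fd, of 1 x y] xy by auto
  have "1 \<le> d"
  proof (rule ccontr)
    assume "\<not> 1 \<le> d"
    \<comment> \<open>Otherwise the set of differences is contained in its own contraction by a factor below one.\<close>
    have contr: "\<exists>a'\<in>C. \<exists>b'\<in>C. a - b = d *\<^sub>R (a' - b')" if "a \<in> C" "b \<in> C" for a b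
      using circumradius_pair_le_iff[OF C fd d0, of a b] d_ge[OF that] by simp
    obtain a b where ab: "a \<in> C" "b \<in> C" "e \<bullet> b < e \<bullet> a"
      "\<And>x. x \<in> C \<Longrightarrow> e \<bullet> b \<le> e \<bullet> x \<and> e \<bullet> x \<le> e \<bullet> a"
      using full_dimensional_width[OF C fd e] by blast
    obtain a' b' where a'b': "a' \<in> C" "b' \<in> C" "a - b = d *\<^sub>R (a' - b')"
      using contr[OF ab(1,2)] by auto
    have "e \<bullet> a - e \<bullet> b = d * (e \<bullet> a' - e \<bullet> b')"
      using arg_cong[OF a'b'(3), of "\<lambda>z. e \<bullet> z"] by (simp add: inner_diff_right)
    also have "\<dots> \<le> d * (e \<bullet> a - e \<bullet> b)"
      using ab(4)[OF a'b'(1)] ab(4)[OF a'b'(2)] d0 by (intro mult_left_mono) auto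
    finally show False
      using ab(3) \<open>\<not> 1 \<le> d\<close> by (simp add: mult_le_cancel_right1)
  qed
  with d1 have d_eq: "circumradius {x, y} C = 1" by (simp add: d_def)
  define K where "K = (\<lambda>(a, b). (1 - s) *\<^sub>R a + s *\<^sub>R b) ` (closed_segment x y \<times> C)"
  have K: "z \<in> K \<longleftrightarrow> (\<exists>a\<in>closed_segment x y. \<exists>b\<in>C. z = (1 - s) *\<^sub>R a + s *\<^sub>R b)" for z
    by (auto simp: K_def)
  have seg: "closed_segment x y \<subseteq> C"
    using xy cvC by (simp add: closed_segment_subset)
  have KC: "K \<subseteq> C"
    using K seg convexD_alt[OF cvC _ _ s] by (metis subset_iff)
  have "x = (1 - s) *\<^sub>R x + s *\<^sub>R x" "y = (1 - s) *\<^sub>R y + s *\<^sub>R y"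
    by (simp_all add: algebra_simps)
  then have xyK: "x \<in> K" "y \<in> K"
    unfolding K using xy by (meson ends_in_segment)+
  have "x \<noteq> y"
  proof
    assume "x = y"
    then have "circumradius {x, y} C \<le> 0"
      using circumradius_pair_le_iff[OF C fd order_refl, of x y] xy by auto
    with d_eq show False by simp
  qed
  have cK: "compact K"
    unfolding K_def case_prod_beta
    by (intro compact_continuous_image compact_Times cC compact_segment continuous_intros)
  have K_eq: "K = (\<Union>a\<in>(\<lambda>a. (1 - s) *\<^sub>R a) ` closed_segment x y. \<Union>b\<in>(\<lambda>b. s *\<^sub>R b) ` C. {a + b})"
    unfolding set_eq_iff K by simp
  have "convex K"
    unfolding K_eq
    by (intro convex_sums convex_scaling convex_closed_segment cvC)
  with cK xyK have bK: "convex_body K" by (auto simp: convex_body_def)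
  have neK: "K \<noteq> {}" using xyK by auto
  have R: "circumradius K C = 1"
  proof (rule antisym)
    have "(\<lambda>z. 0 + z) ` K \<subseteq> (\<lambda>z. 1 *\<^sub>R z) ` C" using KC by simp
    then show "circumradius K C \<le> 1"
      by (rule circumradius_le[OF C fd cK neK zero_le_one])
    show "1 \<le> circumradius K C"
      using circumradius_mono[OF C fd _ cK, of "{x, y}"] xyK d_eq by simp
  qed
  have D: "gauge_diameter K C = 2"
    using gauge_diameter_le[OF C fd cK neK] gauge_diameter_ge[OF C fd cK neK xyK] R d_eq by simp
  have r: "inradius K C = s"
    unfolding inradius_def
  proof (rule Greatest_equality)
    have "s *\<^sub>R c \<in> (\<lambda>z. (- ((1 - s) *\<^sub>R x)) + z) ` K" if "c \<in> C" for c
    proof -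
      have "(1 - s) *\<^sub>R x + s *\<^sub>R c \<in> K" using K that by auto
      moreover have "s *\<^sub>R c = (- ((1 - s) *\<^sub>R x)) + ((1 - s) *\<^sub>R x + s *\<^sub>R c)" by simp
      ultimately show ?thesis by (metis image_eqI)
    qed
    then show "0 \<le> s \<and> (\<exists>t. (\<lambda>z. s *\<^sub>R z) ` C \<subseteq> (\<lambda>z. t + z) ` K)"
      using s by blast
  next
    fix l
    assume "0 \<le> l \<and> (\<exists>t. (\<lambda>z. l *\<^sub>R z) ` C \<subseteq> (\<lambda>z. t + z) ` K)"
    then obtain t where t: "(\<lambda>z. l *\<^sub>R z) ` C \<subseteq> (\<lambda>z. t + z) ` K" by auto
    obtain u where u: "u \<noteq> 0" "u \<bullet> (y - x) = 0"
      using exists_orthogonal_direction[OF n] by blast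
    obtain a b where ab: "a \<in> C" "b \<in> C" "u \<bullet> b < u \<bullet> a"
      "\<And>x. x \<in> C \<Longrightarrow> u \<bullet> b \<le> u \<bullet> x \<and> u \<bullet> x \<le> u \<bullet> a"
      using full_dimensional_width[OF C fd u(1)] by blast
    have "\<exists>w\<in>C. u \<bullet> (l *\<^sub>R z) = u \<bullet> (t + (1 - s) *\<^sub>R x) + s * (u \<bullet> w)" if "z \<in> C" for z
    proof -
      have "l *\<^sub>R z \<in> (\<lambda>z. t + z) ` K" using t that by blast
      then obtain k where k: "k \<in> K" "l *\<^sub>R z = t + k" by (rule imageE) simp
      obtain g w where g: "g \<in> closed_segment x y" and w: "w \<in> C"
        and kgw: "k = (1 - s) *\<^sub>R g + s *\<^sub>R w"
        using k(1) K by auto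
      obtain h where "g = (1 - h) *\<^sub>R x + h *\<^sub>R y" using g by (auto simp: in_segment)
      then have "g = x + h *\<^sub>R (y - x)" by (simp add: algebra_simps)
      then have "u \<bullet> g = u \<bullet> x" using u(2) by (simp add: inner_add_right)
      then have "u \<bullet> (l *\<^sub>R z) = u \<bullet> (t + (1 - s) *\<^sub>R x) + s * (u \<bullet> w)"
        using k(2) kgw by (simp add: inner_add_right)
      then show ?thesis using w by blast
    qed
    then show "l \<le> s"
      using homothet_ratio_le[OF ab, of l] s(1) by blast
  qed
  have "radii_ratios K C = (s, 1)"
    by (simp add: radii_ratios_def R D r)
  moreover have "\<not> (\<exists>p. K = {p})" using xyK \<open>x \<noteq> y\<close> by auto
  ultimately show ?thesis
    using bK unfolding radii_diagram_def by (intro CollectI exI[of _ K]) simp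
qed

section \<open>The diagram of a parallelotope\<close>

text \<open>
  In the coordinates of the parallelotope the norm is a maximum of coordinate
  differences, so a bound on the diameter bounds each coordinate range separately, and the
  translations needed in the different coordinates can be chosen independently.
\<close>

lemma parallelotope_circumradius_le:
  fixes C :: "(real ^ 'n) set"
  assumes "parallelotope C" and C: "convex_body C" and fd: "full_dimensional C"
    and cK: "compact K" and neK: "K \<noteq> {}"
  shows "2 * circumradius K C \<le> gauge_diameter K C"
proof -
  obtain A :: "real ^ 'n ^ 'n" and t0 where A: "invertible A"
    and C_eq: "C = (\<lambda>x. A *v x + t0) ` cbox (- 1) 1"
    using assms(1) by (auto simp: parallelotope_def)
  obtain A' where "A ** A' = mat 1" "A' ** A = mat 1"
    using A by (auto simp: invertible_def)
  then have AA': "A *v (A' *v x) = x" and A'A: "A' *v (A *v x) = x" for x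
    by (simp_all add: matrix_vector_mul_assoc)
  have inC: "A *v z + t0 \<in> C" if "\<And>i. \<bar>z $ i\<bar> \<le> 1" for z
    using that unfolding C_eq by (intro imageI) (auto simp: mem_box_cart abs_le_iff minus_le_iff)
  have Cin: "\<exists>z. x = A *v z + t0 \<and> (\<forall>i. \<bar>z $ i\<bar> \<le> 1)" if "x \<in> C" for x
    using that unfolding C_eq by (auto simp: mem_box_cart abs_le_iff minus_le_iff)
  define d where "d = gauge_diameter K C / 2"
  have d_ge: "circumradius {x, y} C \<le> d" if "x \<in> K" "y \<in> K" for x y
    using gauge_diameter_ge[OF C fd cK neK that] by (simp add: d_def)
  have d0: "0 \<le> d"
  proof -
    obtain x where x: "x \<in> K" using neK by auto
    show ?thesis using d_ge[OF x x] circumradius_nonneg[OF C fd, of "{x, x}"] by simp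
  qed
  have width: "(A' *v x) $ i - (A' *v y) $ i \<le> 2 * d" if xy: "x \<in> K" "y \<in> K" for x y i
  proof -
    obtain a b where ab: "a \<in> C" "b \<in> C" "x - y = d *\<^sub>R (a - b)"
      using circumradius_pair_le_iff[OF C fd d0] d_ge[OF xy] by blast
    obtain z where z: "a = A *v z + t0" "\<bar>z $ i\<bar> \<le> 1" using Cin[OF ab(1)] by auto
    obtain w where w: "b = A *v w + t0" "\<bar>w $ i\<bar> \<le> 1" using Cin[OF ab(2)] by auto
    have "x - y = A *v (d *\<^sub>R (z - w))"
      using ab(3) z(1) w(1)
      by (simp add: matrix_vector_mult_diff_distrib matrix_vector_mult_scaleR)
    then have "A' *v (x - y) = d *\<^sub>R (z - w)" using A'A by simp
    then have "A' *v x - A' *v y = d *\<^sub>R (z - w)" by (simp add: matrix_vector_mult_diff_distrib)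
    then have "(A' *v x - A' *v y) $ i = (d *\<^sub>R (z - w)) $ i" by (rule arg_cong)
    then have "(A' *v x) $ i - (A' *v y) $ i = d * (z $ i - w $ i)"
      unfolding vector_minus_component vector_scaleR_component real_scaleR_def .
    also have "\<dots> \<le> d * 2" using z(2) w(2) d0 by (intro mult_left_mono) auto
    finally show ?thesis by simp
  qed
  \<comment> \<open>The coordinate range has length at most \<open>2 d\<close>, so the value \<open>d\<close> below its maximum works.\<close>
  have "\<exists>m. \<forall>x\<in>K. \<bar>(A' *v x) $ i - m\<bar> \<le> d" for i
  proof -
    have cont: "continuous_on K (\<lambda>x. (A' *v x) $ i)"
      by (intro continuous_intros linear_continuous_on_compose linear_continuous_on matrix_vector_mul_bounded_linear)
    obtain a where a: "a \<in> K" "\<And>x. x \<in> K \<Longrightarrow> (A' *v x) $ i \<le> (A' *v a) $ i"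
      using continuous_attains_sup[OF cK neK cont] by blast
    have "\<bar>(A' *v x) $ i - ((A' *v a) $ i - d)\<bar> \<le> d" if "x \<in> K" for x
      using a(2)[OF that] width[OF a(1) that, of i] by (auto simp: abs_le_iff)
    then show ?thesis by blast
  qed
  then obtain m where m: "\<And>i x. x \<in> K \<Longrightarrow> \<bar>(A' *v x) $ i - m i\<bar> \<le> d" by metis
  define M where "M = (\<chi> i. m i)"
  have "(d *\<^sub>R t0 - A *v M) + x \<in> (\<lambda>z. d *\<^sub>R z) ` C" if "x \<in> K" for x
  proof -
    define z where "z = (1 / d) *\<^sub>R (A' *v x - M)"
    have m': "\<bar>(A' *v x - M) $ i\<bar> \<le> d" for i using m[OF that] by (simp add: M_def)
    have "\<bar>z $ i\<bar> \<le> 1" for i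
      using m'[of i] d0 by (cases "d = 0") (auto simp: z_def abs_mult)
    then have "A *v z + t0 \<in> C" by (rule inC)
    moreover have "d *\<^sub>R z = A' *v x - M"
    proof (cases "d = 0")
      case True
      then have "(A' *v x - M) $ i = 0" for i using m'[of i] by simp
      then show ?thesis using True by (simp add: vec_eq_iff)
    qed (simp add: z_def)
    then have "d *\<^sub>R (A *v z) = x - A *v M"
      by (metis AA' matrix_vector_mult_diff_distrib matrix_vector_mult_scaleR)
    then have "(d *\<^sub>R t0 - A *v M) + x = d *\<^sub>R (A *v z + t0)"
      by (simp add: algebra_simps)
    ultimately show ?thesis by blast
  qed
  then have "circumradius K C \<le> d"
    by (intro circumradius_le[OF C fd cK neK d0, of "d *\<^sub>R t0 - A *v M"]) auto
  then show ?thesis by (simp add: d_def)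
qed

lemma diagram_of_parallelotope:
  fixes C :: "(real ^ 'n) set"
  assumes "parallelotope C" and C: "convex_body C" and fd: "full_dimensional C"
  shows "radii_diagram C \<subseteq> {0..1} \<times> {1}"
proof
  fix p assume "p \<in> radii_diagram C"
  then obtain K where p: "p = radii_ratios K C" and K: "convex_body K" "\<not> (\<exists>q. K = {q})"
    by (auto simp: radii_diagram_def)
  have cK: "compact K" and neK: "K \<noteq> {}" using K by (auto simp: convex_body_def)
  obtain x y where "x \<in> K" "y \<in> K" "x \<noteq> y" using K(2) neK by blast
  then have R: "0 < circumradius K C" using circumradius_pos[OF C fd cK] by blast
  have "gauge_diameter K C = 2 * circumradius K C"
    using parallelotope_circumradius_le[OF assms cK neK] gauge_diameter_le[OF C fd cK neK] by simp
  moreover have "0 \<le> inradius K C" "inradius K C \<le> circumradius K C"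
    using inradius_properties[OF C fd cK neK] by auto
  ultimately show "p \<in> {0..1} \<times> {1}"
    using R by (simp add: p radii_ratios_def)
qed

section \<open>From the diagram to an intersection property\<close>

text \<open>
  Pairwise closeness in the norm of the difference body says that the diameter is at most two.
  If the diagram is the segment, the circumradius is half the diameter, hence at most one, and
  convexity of \<open>C\<close> puts a smaller homothet of \<open>C\<close> into a translate of \<open>C\<close>.
\<close>

lemma translate_into_gauge:
  fixes C :: "(real ^ 'n) set"
  assumes C: "convex_body C" and fd: "full_dimensional C"
    and diagram: "radii_diagram C \<subseteq> {0..1} \<times> {1}"
    and K: "convex_body K"
    and diff: "\<And>x y. x \<in> K \<Longrightarrow> y \<in> K \<Longrightarrow> \<exists>a\<in>C. \<exists>b\<in>C. x - y = a - b"
  shows "\<exists>t. \<forall>x\<in>K. t + x \<in> C"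
proof (cases "\<exists>q. K = {q}")
  case True
  then obtain q where "K = {q}" by auto
  moreover obtain c where "c \<in> C" using C by (auto simp: convex_body_def)
  ultimately show ?thesis by (intro exI[of _ "c - q"]) auto
next
  case False
  have cK: "compact K" and neK: "K \<noteq> {}" using K by (auto simp: convex_body_def)
  have cvC: "convex C" using C by (simp add: convex_body_def)
  let ?R = "circumradius K C"
  obtain x y where "x \<in> K" "y \<in> K" "x \<noteq> y" using False neK by blast
  then have R: "0 < ?R" using circumradius_pos[OF C fd cK] by blast
  have "radii_ratios K C \<in> radii_diagram C"
    using K False by (auto simp: radii_diagram_def)
  then have "gauge_diameter K C = 2 * ?R"
    using diagram R by (auto simp: radii_ratios_def)
  moreover obtain v w where vw: "v \<in> K" "w \<in> K" "gauge_diameter K C = 2 * circumradius {v, w} C"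
    using gauge_diameter_attained[OF C fd cK neK] by blast
  moreover have "circumradius {v, w} C \<le> 1"
    using circumradius_pair_le_iff[OF C fd, of 1 v w] diff[OF vw(1,2)] by simp
  ultimately have R1: "?R \<le> 1" by simp
  obtain t where t: "(\<lambda>x. t + x) ` K \<subseteq> (\<lambda>x. ?R *\<^sub>R x) ` C"
    using circumradius_attained[OF C fd cK neK] by auto
  obtain c where c: "c \<in> C" using C by (auto simp: convex_body_def)
  have "((1 - ?R) *\<^sub>R c + t) + z \<in> C" if "z \<in> K" for z
  proof -
    have "t + z \<in> (\<lambda>x. ?R *\<^sub>R x) ` C" using t that by blast
    then obtain k where "k \<in> C" "t + z = ?R *\<^sub>R k" by (rule imageE) simp
    then have "((1 - ?R) *\<^sub>R c + t) + z = (1 - ?R) *\<^sub>R c + ?R *\<^sub>R k"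
      by (simp add: add.assoc)
    then show ?thesis using convexD_alt[OF cvC c \<open>k \<in> C\<close>, of ?R] R R1 by (simp only: less_imp_le)
  qed
  then show ?thesis by blast
qed

section \<open>Touching balls\<close>

text \<open>
  A ball in \<open>C\<close> with centre \<open>q\<close> whose boundary point \<open>q + u\<close> has \<open>u\<close> as a supporting normal of \<open>C\<close>.
  Near the contact point \<open>C\<close> is then squeezed between the ball and the half-space, and behaves
  to first order like the half-space; such points take the role of smooth boundary points.
\<close>

definition touching_ball :: "(real ^ 'n) set \<Rightarrow> real ^ 'n \<Rightarrow> real ^ 'n \<Rightarrow> bool" where
  "touching_ball C q u \<longleftrightarrow>
    u \<noteq> 0 \<and> cball q (norm u) \<subseteq> C \<and> (\<forall>z\<in>C. u \<bullet> z \<le> u \<bullet> (q + u))"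

text \<open>
  The largest ball in \<open>C\<close> about an interior point touches the frontier at a nearest frontier point.
  Any hyperplane supporting \<open>C\<close> there also supports the ball, so its normal is the radius.
\<close>

lemma touching_ball_at_nearest_point:
  fixes C :: "(real ^ 'n) set"
  assumes cv: "convex C" and cl: "closed C" and q: "q \<in> interior C" and p: "p \<in> frontier C"
    and nearest: "\<And>z. z \<in> frontier C \<Longrightarrow> dist q p \<le> dist q z"
  shows "touching_ball C q (p - q)"
proof -
  define u where "u = p - q"
  have u0: "u \<noteq> 0" using p q by (auto simp: u_def frontier_def)
  have qC: "q \<in> C" using q interior_subset by blast
  have pu: "p = q + u" by (simp add: u_def)
  have "ball q (norm u) \<subseteq> C"
  proof
    fix z assume z: "z \<in> ball q (norm u)"
    show "z \<in> C"
    proof (rule ccontr)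
      assume "z \<notin> C"
      then obtain w where w: "w \<in> closed_segment q z" "w \<in> frontier C"
        using connected_Int_frontier[of "closed_segment q z" C] qC by auto
      have "dist q w \<le> dist q z"
        using dist_in_closed_segment[OF w(1)] by (simp add: dist_commute)
      then show False
        using nearest[OF w(2)] z by (simp add: u_def dist_norm norm_minus_commute)
    qed
  qed
  then have cb: "cball q (norm u) \<subseteq> C"
    using closure_minimal[OF _ cl, of "ball q (norm u)"] closure_ball[of "norm u" q] u0 by simp
  have "p \<in> closure C" "p \<notin> rel_interior C"
    using p q rel_interior_nonempty_interior[of C] by (auto simp: frontier_def)
  then obtain b where b: "b \<noteq> 0" "\<And>z. z \<in> closure C \<Longrightarrow> b \<bullet> p \<le> b \<bullet> z"
    using supporting_hyperplane_relative_frontier[OF cv] by metis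
  define a where "a = - b"
  have a0: "a \<noteq> 0" using b by (simp add: a_def)
  have a: "a \<bullet> z \<le> a \<bullet> p" if "z \<in> C" for z
    using b(2)[of z] that closure_subset[of C] by (auto simp: a_def)
  \<comment> \<open>The ball has a point in direction \<open>a\<close>; the support inequality there is the equality case of
    Cauchy--Schwarz, so the supporting normal is parallel to the radius.\<close>
  have "q + (norm u / norm a) *\<^sub>R a \<in> cball q (norm u)" using a0 by (simp add: dist_norm)
  then have "a \<bullet> (q + (norm u / norm a) *\<^sub>R a) \<le> a \<bullet> p" using a cb by blast
  then have "norm a * norm u \<le> a \<bullet> u"
    using a0 by (simp add: pu inner_add_right dot_square_norm power2_eq_square mult.commute)
  then have "a \<bullet> u = norm a * norm u" using norm_cauchy_schwarz[of a u] by simp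
  then have par: "norm a *\<^sub>R u = norm u *\<^sub>R a" by (simp add: norm_cauchy_schwarz_eq)
  have "u \<bullet> z \<le> u \<bullet> p" if "z \<in> C" for z
  proof -
    have "norm a * (u \<bullet> z) = norm u * (a \<bullet> z)" by (metis par inner_scaleR_left)
    also have "\<dots> \<le> norm u * (a \<bullet> p)" using a[OF that] by (intro mult_left_mono) auto
    also have "\<dots> = norm a * (u \<bullet> p)" by (metis par inner_scaleR_left)
    finally show ?thesis using a0 by simp
  qed
  then show ?thesis
    using u0 cb by (simp add: touching_ball_def u_def)
qed

text \<open>
  The supporting half-spaces at contact points of balls already cut out \<open>C\<close>. To separate an
  exterior point \<open>x\<close>, take the frontier point \<open>y\<close> on the segment from an interior point \<open>c\<close> to \<open>x\<close>, move slightly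
  from \<open>y\<close> towards \<open>c\<close>, and take the largest ball in \<open>C\<close> about the new centre \<open>q\<close>. Its contact point is as
  close to \<open>y\<close> as desired. Since the half-space there contains the fixed ball about \<open>c\<close>, its
  normal makes a definite angle with the direction of the segment, so the half-space ends before \<open>x\<close>.
\<close>

lemma touching_ball_separates:
  fixes C :: "(real ^ 'n) set"
  assumes cv: "convex C" and cl: "closed C" and r: "0 < r" and cb: "cball c r \<subseteq> C" and x: "x \<notin> C"
  obtains q u where "touching_ball C q u" and "u \<bullet> (q + u) < u \<bullet> x"
proof -
  have c: "c \<in> C" "c \<in> interior C" using r cb by (auto simp: mem_interior_cball)
  obtain y where y: "y \<in> closed_segment c x" "y \<in> frontier C"
    using connected_Int_frontier[of "closed_segment c x" C] c x by auto
  have yC: "y \<in> C" using y(2) cl by (simp add: frontier_def)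
  obtain s where s: "0 \<le> s" "s \<le> 1" "y = (1 - s) *\<^sub>R c + s *\<^sub>R x" using y(1) by (auto simp: in_segment)
  have "s \<noteq> 0" using s(3) y(2) c by (auto simp: frontier_def)
  moreover have "s \<noteq> 1" using s(3) yC x by auto
  ultimately have s01: "0 < s" "s < 1" using s by auto
  define k where "k = (1 - s) / s"
  have k: "0 < k" using s01 by (simp add: k_def)
  have yc: "y - c = s *\<^sub>R (x - c)" and xy: "x - y = (1 - s) *\<^sub>R (x - c)"
    using s(3) by (simp_all add: algebra_simps)
  have xyk: "x - y = k *\<^sub>R (y - c)" using s01 by (simp add: yc xy k_def)
  have "y \<noteq> c" using y(2) c by (auto simp: frontier_def)
  then have e: "0 < norm (y - c)" by simp
  \<comment> \<open>\<open>m\<close> bounds \<open>norm u\<close>: with \<open>x - y = k (y - c)\<close> and \<open>u \<bullet> (y - c) \<ge> r norm u - (norm u)\<^sup>2\<close>, the final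
    inequality amounts to \<open>(k + 1) norm u < k r\<close>.\<close>
  define m where "m = k * r / (k + 1)"
  have m: "0 < m" using k r by (simp add: m_def)
  define h where "h = min (1 / 2) (m / (2 * norm (y - c)))"
  have h: "0 < h" "h < 1" using m e by (auto simp: h_def)
  have "h * norm (y - c) \<le> (m / (2 * norm (y - c))) * norm (y - c)"
    using e by (intro mult_right_mono) (auto simp: h_def)
  also have "\<dots> < m" using e m by simp
  finally have small: "h * norm (y - c) < m" .
  define q where "q = y - h *\<^sub>R (y - c)"
  have q: "q \<in> interior C"
    unfolding q_def using mem_interior_convex_shrink[OF cv c(2) yC] h by simp
  obtain p where p: "p \<in> frontier C" "\<And>z. z \<in> frontier C \<Longrightarrow> dist q p \<le> dist q z"
    using distance_attains_inf[OF frontier_closed, of C q] y(2) by blast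
  define u where "u = p - q"
  have tb: "touching_ball C q u"
    unfolding u_def by (rule touching_ball_at_nearest_point[OF cv cl q p])
  have u0: "0 < norm u" using tb by (simp add: touching_ball_def)
  have "norm u \<le> norm (y - q)"
    using p(2)[OF y(2)] by (simp add: u_def dist_norm norm_minus_commute)
  also have "\<dots> = h * norm (y - c)" using h by (simp add: q_def)
  finally have "norm u < m" using small by simp
  then have small_u: "(k + 1) * norm u < k * r" using k by (simp add: m_def field_simps)
  have "c + (r / norm u) *\<^sub>R u \<in> cball c r" using r u0 by (simp add: dist_norm)
  then have "u \<bullet> (c + (r / norm u) *\<^sub>R u) \<le> u \<bullet> (q + u)"
    using cb tb by (auto simp: touching_ball_def)
  then have uqc: "r * norm u - norm u * norm u \<le> u \<bullet> (q - c)"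
    using u0 by (simp add: inner_add_right inner_diff_right dot_square_norm power2_eq_square)
  have ru: "norm u < r"
  proof -
    have "k * norm u < k * r" using small_u u0 unfolding distrib_right by linarith
    then show ?thesis using k by simp
  qed
  then have pos: "0 \<le> r * norm u - norm u * norm u" using u0 by simp
  have qc: "q - c = (1 - h) *\<^sub>R (y - c)" by (simp add: q_def algebra_simps)
  have uyc: "r * norm u - norm u * norm u \<le> u \<bullet> (y - c)"
  proof -
    have "u \<bullet> (q - c) = (1 - h) * (u \<bullet> (y - c))" by (simp add: qc)
    moreover from this have "0 \<le> (1 - h) * (u \<bullet> (y - c))"
      using uqc pos by linarith
    then have "0 \<le> u \<bullet> (y - c)"
      using h by (simp add: zero_le_mult_iff)
    then have "(1 - h) * (u \<bullet> (y - c)) \<le> 1 * (u \<bullet> (y - c))"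
      using h by (intro mult_right_mono) auto
    ultimately show ?thesis using uqc by simp
  qed
  have "x - q = (k + h) *\<^sub>R (y - c)"
    using xyk by (simp add: q_def algebra_simps)
  then have "u \<bullet> x - u \<bullet> q = (k + h) * (u \<bullet> (y - c))"
    by (metis inner_diff_right inner_scaleR_right)
  also have "\<dots> \<ge> k * (r * norm u - norm u * norm u)"
    using uyc pos k h by (intro mult_mono) auto
  finally have "k * (r * norm u - norm u * norm u) \<le> u \<bullet> x - u \<bullet> q" .
  moreover have "norm u * norm u < k * (r * norm u - norm u * norm u)"
  proof -
    have "((k + 1) * norm u) * norm u < (k * r) * norm u" using small_u u0 by simp
    then show ?thesis by (simp add: algebra_simps)
  qed
  ultimately have "u \<bullet> (q + u) < u \<bullet> x"
    by (simp add: inner_add_right dot_square_norm power2_eq_square)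
  then show thesis using that tb by blast
qed

text \<open>
  The touching ball contains a short initial piece of every ray that enters the open
  half-space from the contact point.
\<close>

lemma touching_ball_inward:
  fixes C :: "(real ^ 'n) set"
  assumes "touching_ball C q u" and "u \<bullet> d < 0"
  shows "\<forall>\<^sub>F e in at_right 0. q + u + e *\<^sub>R d \<in> C"
proof -
  have d: "0 < d \<bullet> d" using assms(2) by auto
  \<comment> \<open>The ray leaves the sphere about \<open>q\<close> again at parameter \<open>b\<close>.\<close>
  define b where "b = - 2 * (u \<bullet> d) / (d \<bullet> d)"
  have b: "0 < b" using assms(2) d by (simp add: b_def divide_neg_pos)
  have "q + u + e *\<^sub>R d \<in> C" if e: "0 < e" "e < b" for e
  proof -
    have "e * (d \<bullet> d) < - 2 * (u \<bullet> d)" using e d by (simp add: b_def field_simps)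
    then have "e * (e * (d \<bullet> d)) < e * (- 2 * (u \<bullet> d))" using e by (intro mult_strict_left_mono) auto
    moreover have "(u + e *\<^sub>R d) \<bullet> (u + e *\<^sub>R d) = u \<bullet> u + 2 * e * (u \<bullet> d) + e * (e * (d \<bullet> d))"
      by (simp add: inner_add_left inner_add_right inner_commute algebra_simps)
    ultimately have "(u + e *\<^sub>R d) \<bullet> (u + e *\<^sub>R d) \<le> u \<bullet> u" by simp
    then have "norm (u + e *\<^sub>R d) \<le> norm u" by (simp add: norm_le)
    then have "q + u + e *\<^sub>R d \<in> cball q (norm u)" 
      using norm_minus_cancel[of "u + e *\<^sub>R d"] by (simp add: dist_norm)
    then show ?thesis using assms(1) by (auto simp: touching_ball_def)
  qed
  then show ?thesis using b by (auto simp: eventually_at_right_field)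
qed

section \<open>Positive circuits of touching normals\<close>

text \<open>
  Half-spaces whose outer normals are not opposite have a common point arbitrarily deep in both;
  the sum of the two unit normals points into such a direction.
\<close>

lemma common_halfspace_point:
  fixes u v :: "real ^ 'n"
  assumes "u \<noteq> 0" and "v \<noteq> 0" and "u \<bullet> v \<noteq> - (norm u * norm v)"
  obtains w where "u \<bullet> u < u \<bullet> w" and "v \<bullet> v < v \<bullet> w"
proof -
  have gt: "- (norm u * norm v) < u \<bullet> v"
    using assms(3) Cauchy_Schwarz_ineq2[of u v] by linarith
  define m where "m = 1 + (u \<bullet> v) / (norm u * norm v)"
  have nuv: "0 < norm u" "0 < norm v" using assms by auto
  have m: "0 < m" using gt nuv by (simp add: m_def field_simps)
  define w where "w = ((norm u + norm v) / m) *\<^sub>R ((1 / norm u) *\<^sub>R u + (1 / norm v) *\<^sub>R v)"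
  have "u \<bullet> ((1 / norm u) *\<^sub>R u + (1 / norm v) *\<^sub>R v) = norm u * m"
    using nuv by (simp add: m_def inner_add_right dot_square_norm power2_eq_square field_simps)
  then have "u \<bullet> w = (norm u + norm v) * norm u" using m by (simp add: w_def)
  then have "u \<bullet> u < u \<bullet> w" using nuv by (simp add: dot_square_norm power2_eq_square distrib_right)
  moreover have "v \<bullet> ((1 / norm u) *\<^sub>R u + (1 / norm v) *\<^sub>R v) = norm v * m"
    using nuv by (simp add: m_def inner_add_right dot_square_norm power2_eq_square field_simps inner_commute)
  then have "v \<bullet> w = (norm u + norm v) * norm v" using m by (simp add: w_def)
  then have "v \<bullet> v < v \<bullet> w" using nuv by (simp add: dot_square_norm power2_eq_square distrib_right)
  ultimately show thesis using that by blast
qed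

text \<open>
  Membership of a difference in a convex set is a convex condition in each of the two
  points.
\<close>

lemma convex_hull_differences:
  fixes D :: "(real ^ 'n) set"
  assumes "convex D" and "\<And>x y. x \<in> X \<Longrightarrow> y \<in> Y \<Longrightarrow> x - y \<in> D"
    and "x \<in> convex hull X" and "y \<in> convex hull Y"
  shows "x - y \<in> D"
proof -
  have l: "convex {z. z - b \<in> D}" for b
  proof -
    have "{z. z - b \<in> D} = (\<lambda>z. b + z) ` D" by (force simp: image_iff)
    then show ?thesis using assms(1) by (simp add: convex_translation)
  qed
  have r: "convex {b. z - b \<in> D}" for z
  proof -
    have "{b. z - b \<in> D} = (\<lambda>d. z + d) ` uminus ` D" by (force simp: image_iff)
    then show ?thesis using assms(1) by (simp add: convex_translation convex_negations)
  qed
  have "x - b \<in> D" if "b \<in> Y" for b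
    using hull_minimal[of X "{z. z - b \<in> D}" convex] l assms(2)[OF _ that] assms(3) by auto
  then show ?thesis
    using hull_minimal[of Y "{b. x - b \<in> D}" convex] r assms(4) by auto
qed

text \<open>
  Shift the contact point with normal \<open>v i\<close> by a small multiple of \<open>v i\<close> to a point \<open>x i\<close> just outside its half-space.
  Two of these points still fit into a translate of \<open>C\<close>: as their
  normals are not opposite, one common small shift brings both back into \<open>C\<close>
  (\<open>common_halfspace_point\<close>, \<open>touching_ball_inward\<close>). By the
  intersection property all points fit into one translate, and its shift has a negative inner
  product with every normal. A positive combination of the normals therefore cannot vanish.
\<close>

lemma no_positive_circuit:
  fixes C :: "(real ^ 'n) set"
  assumes cv: "convex C"
    and helly: "\<And>K. convex_body K \<Longrightarrow>
        (\<And>x y. x \<in> K \<Longrightarrow> y \<in> K \<Longrightarrow> \<exists>a\<in>C. \<exists>b\<in>C. x - y = a - b) \<Longrightarrow> \<exists>t. \<forall>x\<in>K. t + x \<in> C"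
    and I: "finite I" "I \<noteq> {}"
    and tb: "\<And>i. i \<in> I \<Longrightarrow> touching_ball C (q i) (v i)"
    and no_opposite: "\<And>i j. i \<in> I \<Longrightarrow> j \<in> I \<Longrightarrow> v i \<bullet> v j \<noteq> - (norm (v i) * norm (v j))"
    and pos: "\<And>i. i \<in> I \<Longrightarrow> 0 < c i"
  shows "(\<Sum>i\<in>I. c i *\<^sub>R v i) \<noteq> 0"
proof
  assume sum0: "(\<Sum>i\<in>I. c i *\<^sub>R v i) = 0"
  have v0: "v i \<noteq> 0" if "i \<in> I" for i using tb[OF that] by (simp add: touching_ball_def)
  have "\<exists>w. v i \<bullet> v i < v i \<bullet> w \<and> v j \<bullet> v j < v j \<bullet> w" if "i \<in> I" "j \<in> I" for i j
    using common_halfspace_point[OF v0[OF that(1)] v0[OF that(2)] no_opposite[OF that]] by metis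
  then obtain w where w: "\<And>i j. i \<in> I \<Longrightarrow> j \<in> I \<Longrightarrow>
      v i \<bullet> v i < v i \<bullet> w i j \<and> v j \<bullet> v j < v j \<bullet> w i j"
    by metis
  have "\<forall>\<^sub>F e in at_right (0 :: real). q i + v i + e *\<^sub>R (v i - w i j) \<in> C \<and>
      q j + v j + e *\<^sub>R (v j - w i j) \<in> C" if "i \<in> I" "j \<in> I" for i j
    using w[OF that] that
    by (intro eventually_conj touching_ball_inward tb) (auto simp: inner_diff_right)
  then have "\<forall>\<^sub>F e in at_right (0 :: real). \<forall>i\<in>I. \<forall>j\<in>I. q i + v i + e *\<^sub>R (v i - w i j) \<in> C \<and>
      q j + v j + e *\<^sub>R (v j - w i j) \<in> C"
    by (intro eventually_ball_finite I(1) ballI)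
  then have "\<forall>\<^sub>F e in at_right (0 :: real). 0 < e \<and> (\<forall>i\<in>I. \<forall>j\<in>I.
      q i + v i + e *\<^sub>R (v i - w i j) \<in> C \<and> q j + v j + e *\<^sub>R (v j - w i j) \<in> C)"
    by (intro eventually_conj eventually_at_right_less)
  then obtain e :: real where e: "0 < e"
    and inC: "\<And>i j. i \<in> I \<Longrightarrow> j \<in> I \<Longrightarrow>
      q i + v i + e *\<^sub>R (v i - w i j) \<in> C \<and> q j + v j + e *\<^sub>R (v j - w i j) \<in> C"
    using eventually_happens'[OF trivial_limit_at_right_real] by blast
  define x where "x i = q i + v i + e *\<^sub>R v i" for i
  let ?D = "\<Union>a\<in>C. \<Union>b\<in>C. {a - b}"
  have diff: "x i - x j \<in> ?D" if "i \<in> I" "j \<in> I" for i j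
  proof -
    have "x i - x j = (q i + v i + e *\<^sub>R (v i - w i j)) - (q j + v j + e *\<^sub>R (v j - w i j))"
      by (simp add: x_def algebra_simps)
    then show ?thesis using inC[OF that] by blast
  qed
  have "convex ?D" by (rule convex_differences[OF cv cv])
  then have "a - b \<in> ?D" if "a \<in> convex hull (x ` I)" "b \<in> convex hull (x ` I)" for a b
    using convex_hull_differences[OF _ _ that, of ?D] diff by blast
  moreover have "convex_body (convex hull (x ` I))"
    using I by (simp add: convex_body_def finite_imp_compact_convex_hull)
  ultimately obtain t where t: "\<And>y. y \<in> convex hull (x ` I) \<Longrightarrow> t + y \<in> C"
    using helly[of "convex hull (x ` I)"] by blast
  have neg: "v i \<bullet> t < 0" if "i \<in> I" for i
  proof -
    have "t + x i \<in> C" using that by (intro t hull_inc) auto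
    then have "v i \<bullet> (t + x i) \<le> v i \<bullet> (q i + v i)" using tb[OF that] by (simp add: touching_ball_def)
    then have "v i \<bullet> t + e * (v i \<bullet> v i) \<le> 0" by (simp add: x_def inner_add_right)
    moreover have "0 < e * (v i \<bullet> v i)" using e v0[OF that] by simp
    ultimately show ?thesis by linarith
  qed
  have "(\<Sum>i\<in>I. c i * (v i \<bullet> t)) < 0"
    using sum_strict_mono[OF I, of "\<lambda>i. c i * (v i \<bullet> t)" "\<lambda>_. 0"] neg pos
    by (simp add: mult_pos_neg)
  moreover have "(\<Sum>i\<in>I. c i * (v i \<bullet> t)) = (\<Sum>i\<in>I. c i *\<^sub>R v i) \<bullet> t"
    by (simp add: inner_sum_left)
  ultimately show False using sum0 by simp
qed

text \<open>
  If a touching normal \<open>u\<close> is not a multiple of a basis element, its expansion in a basis of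
  touching normals becomes a positive relation after the sign of each basis element is
  chosen opposite to its coefficient; symmetry keeps the changed elements touching normals. No two
  vectors of the relation are opposite, so it is excluded as a positive circuit.
\<close>

lemma touching_normals_multiples_of_basis:
  fixes C :: "(real ^ 'n) set"
  assumes cv: "convex C"
    and helly: "\<And>K. convex_body K \<Longrightarrow>
        (\<And>x y. x \<in> K \<Longrightarrow> y \<in> K \<Longrightarrow> \<exists>a\<in>C. \<exists>b\<in>C. x - y = a - b) \<Longrightarrow> \<exists>t. \<forall>x\<in>K. t + x \<in> C"
    and sym: "\<And>q u. touching_ball C q u \<Longrightarrow> \<exists>q'. touching_ball C q' (- u)"
    and B: "independent B" "span B = UNIV" "\<And>b. b \<in> B \<Longrightarrow> \<exists>q. touching_ball C q b"
    and u: "touching_ball C q u"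
  shows "\<exists>b\<in>B. \<exists>k. u = k *\<^sub>R b"
proof (rule ccontr)
  assume not: "\<not> (\<exists>b\<in>B. \<exists>k. u = k *\<^sub>R b)"
  have finB: "finite B" using B(1) by (rule independent_imp_finite)
  have "u \<in> span B" using B(2) by simp
  then obtain c where c: "u = (\<Sum>b\<in>B. c b *\<^sub>R b)"
    by (auto simp: span_finite[OF finB])
  have uB: "u \<notin> B" using not scaleR_one by metis
  define J where "J = {b \<in> B. c b \<noteq> 0}"
  define v where "v i = (if i = u then u else - sgn (c i) *\<^sub>R i)" for i
  define l where "l i = (if i = u then 1 else \<bar>c i\<bar>)" for i
  have uJ: "u \<notin> J" using uB by (simp add: J_def)
  have finJ: "finite J" using finB by (simp add: J_def)
  have "\<exists>q. touching_ball C q (v i)" if "i \<in> insert u J" for i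
  proof (cases "i = u")
    case True
    then show ?thesis using u by (auto simp: v_def)
  next
    case False
    then have "i \<in> B" "c i \<noteq> 0" using that by (auto simp: J_def)
    then show ?thesis
      using B(3)[of i] sym[of _ i] False by (auto simp: v_def sgn_if)
  qed
  then obtain p where p: "\<And>i. i \<in> insert u J \<Longrightarrow> touching_ball C (p i) (v i)" by metis
  have v0: "v i \<noteq> 0" if "i \<in> insert u J" for i using p[OF that] by (simp add: touching_ball_def)
  have not_mult: "i = j" if "i \<in> insert u J" "j \<in> insert u J" and vv: "v i = k *\<^sub>R v j" for i j k
  proof (rule ccontr)
    assume ij: "i \<noteq> j"
    have k0: "k \<noteq> 0" using vv v0[OF that(1)] by auto
    have vv': "v j = (1 / k) *\<^sub>R v i" using vv k0 by simp
    consider "i = u" | "j = u" | "i \<noteq> u" "j \<noteq> u" by auto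
    then show False
    proof cases
      case 1
      then have "u = (k * (- sgn (c j))) *\<^sub>R j" using vv ij by (simp add: v_def)
      moreover have "j \<in> B" using that(2) ij 1 by (simp add: J_def)
      ultimately show False using not by blast
    next
      case 2
      then have "u = ((1 / k) * (- sgn (c i))) *\<^sub>R i" using vv' ij by (simp add: v_def)
      moreover have "i \<in> B" using that(1) ij 2 by (simp add: J_def)
      ultimately show False using not by blast
    next
      case 3
      then have iB: "i \<in> B" "c i \<noteq> 0" and jB: "j \<in> B" using that by (auto simp: J_def)
      have "sgn (c i) *\<^sub>R i = (k * sgn (c j)) *\<^sub>R j" using vv 3 by (simp add: v_def)
      then have "sgn (c i) *\<^sub>R (sgn (c i) *\<^sub>R i) = (sgn (c i) * (k * sgn (c j))) *\<^sub>R j"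
        by simp
      moreover have "sgn (c i) *\<^sub>R (sgn (c i) *\<^sub>R i) = i"
        using iB(2) by (simp add: sgn_if)
      ultimately have "i = (sgn (c i) * (k * sgn (c j))) *\<^sub>R j" by simp
      moreover have "j \<in> span (B - {i})" using jB ij by (intro span_base) auto
      ultimately have "i \<in> span (B - {i})" using span_scale by metis
      then show False using B(1) iB(1) by (auto simp: dependent_def)
    qed
  qed
  have opp: "v i \<bullet> v j \<noteq> - (norm (v i) * norm (v j))" if ij: "i \<in> insert u J" "j \<in> insert u J" for i j
  proof
    assume eq: "v i \<bullet> v j = - (norm (v i) * norm (v j))"
    then have "v i \<bullet> (- v j) = norm (v i) * norm (- v j)" by simp
    then have "norm (v i) *\<^sub>R (- v j) = norm (v j) *\<^sub>R v i"
      using norm_cauchy_schwarz_eq[of "v i" "- v j"] by simp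
    then have "(1 / norm (v j)) *\<^sub>R (norm (v j) *\<^sub>R v i) = (1 / norm (v j)) *\<^sub>R (norm (v i) *\<^sub>R (- v j))"
      by simp
    then have "v i = (- norm (v i) / norm (v j)) *\<^sub>R v j"
      using v0[OF ij(2)] by simp
    then have "i = j" using not_mult[OF ij] by blast
    then have "v i \<bullet> v i \<le> 0" using eq by simp
    then show False using v0[OF ij(1)] by (metis inner_gt_zero_iff not_le)
  qed
  have "(\<Sum>i\<in>insert u J. l i *\<^sub>R v i) = u + (\<Sum>i\<in>J. l i *\<^sub>R v i)"
    using finJ uJ by (simp add: l_def v_def)
  also have "(\<Sum>i\<in>J. l i *\<^sub>R v i) = (\<Sum>i\<in>J. - (c i *\<^sub>R i))"
  proof (rule sum.cong)
    fix i assume "i \<in> J"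
    then have "i \<noteq> u" using uJ by auto
    then show "l i *\<^sub>R v i = - (c i *\<^sub>R i)" by (simp add: l_def v_def abs_mult_sgn)
  qed simp
  also have "\<dots> = - (\<Sum>i\<in>B. c i *\<^sub>R i)"
    unfolding sum_negf J_def using finB by (subst sum.inter_filter) (auto intro!: sum.cong)
  finally have "(\<Sum>i\<in>insert u J. l i *\<^sub>R v i) = 0" using c by simp
  moreover have "(\<Sum>i\<in>insert u J. l i *\<^sub>R v i) \<noteq> 0"
  proof (rule no_positive_circuit[OF cv helly])
    show "0 < l i" if "i \<in> insert u J" for i using that by (auto simp: l_def J_def)
  qed (use finJ p opp in auto)
  ultimately show False by simp
qed

text \<open>
  Normalising the slabs to width two and centring them gives the rows of the inverse of the
  affine map from the cube.
\<close>

lemma parallelotope_if_slabs: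
  fixes B :: "(real ^ 'n) set"
  assumes B: "independent B" "span B = UNIV" and lt: "\<And>b. b \<in> B \<Longrightarrow> lo b < hi b"
    and C: "\<And>x. x \<in> C \<longleftrightarrow> (\<forall>b\<in>B. lo b \<le> b \<bullet> x \<and> b \<bullet> x \<le> hi b)"
  shows "parallelotope C"
proof -
  have finB: "finite B" using B(1) by (rule independent_imp_finite)
  have "card B = CARD('n)"
    using dim_eq_card_independent[OF B(1)] dim_span[of B] B(2) by simp
  then obtain f :: "'n \<Rightarrow> real ^ 'n" where f: "bij_betw f UNIV B"
    using finite_same_card_bij[of "UNIV :: 'n set" B] finB by auto
  have fB: "f i \<in> B" for i using f by (auto simp: bij_betw_def)
  have surj: "\<exists>i. b = f i" if "b \<in> B" for b using f that by (auto simp: bij_betw_def)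
  define w where "w b = (hi b - lo b) / 2" for b
  define m where "m b = (hi b + lo b) / 2" for b
  have w: "0 < w (f i)" for i using lt[OF fB] by (simp add: w_def)
  define M :: "real ^ 'n ^ 'n" where "M = (\<chi> i. (1 / w (f i)) *\<^sub>R f i)"
  define s :: "real ^ 'n" where "s = (\<chi> i. m (f i) / w (f i))"
  have Mx: "(M *v x) $ i = (f i \<bullet> x) / w (f i)" for x i
    by (simp add: M_def matrix_vector_mul_component)
  have "inj ((*v) M)"
  proof (rule injI)
    fix x y assume "M *v x = M *v y"
    then have "f i \<bullet> (x - y) = 0" for i
      using Mx[of x i] Mx[of y i] w[of i] by (simp add: inner_diff_right)
    then have "b \<bullet> (x - y) = 0" if "b \<in> B" for b using surj[OF that] by auto
    then have "orthogonal (x - y) b" if "b \<in> B" for b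
      using that by (simp add: orthogonal_def inner_commute)
    moreover have "x - y \<in> span B" using B(2) by simp
    ultimately have "orthogonal (x - y) (x - y)" using orthogonal_to_span by blast
    then show "x = y" by (simp add: orthogonal_self)
  qed
  then have "invertible M"
    by (simp add: invertible_left_inverse matrix_left_invertible_injective)
  then obtain A where A: "M ** A = mat 1" "A ** M = mat 1" by (auto simp: invertible_def)
  then have MA: "M *v (A *v x) = x" and AM: "A *v (M *v x) = x" for x
    by (simp_all add: matrix_vector_mul_assoc)
  have C_iff: "x \<in> C \<longleftrightarrow> M *v x - s \<in> cbox (- 1) 1" for x
  proof -
    have "x \<in> C \<longleftrightarrow> (\<forall>i. lo (f i) \<le> f i \<bullet> x \<and> f i \<bullet> x \<le> hi (f i))"
      using C fB surj by metis
    also have "\<dots> \<longleftrightarrow> (\<forall>i. - 1 \<le> (M *v x - s) $ i \<and> (M *v x - s) $ i \<le> 1)"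
    proof (intro all_cong1 arg_cong2[where f = "(\<and>)"])
      fix i
      have e: "(M *v x - s) $ i = (f i \<bullet> x - m (f i)) / w (f i)"
        by (simp add: Mx s_def diff_divide_distrib)
      show "(lo (f i) \<le> f i \<bullet> x) = (- 1 \<le> (M *v x - s) $ i)"
        unfolding e pos_le_divide_eq[OF w] by (simp add: w_def m_def field_simps)
      show "(f i \<bullet> x \<le> hi (f i)) = ((M *v x - s) $ i \<le> 1)"
        unfolding e pos_divide_le_eq[OF w] by (simp add: w_def m_def field_simps)
    qed
    finally show ?thesis by (simp add: mem_box_cart)
  qed
  have "C = (\<lambda>z. A *v z + A *v s) ` cbox (- 1) 1"
  proof (intro set_eqI iffI)
    fix x assume "x \<in> C"
    then have "M *v x - s \<in> cbox (- 1) 1" using C_iff by simp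
    moreover have "x = A *v (M *v x - s) + A *v s"
      by (simp add: AM matrix_vector_mult_diff_distrib)
    ultimately show "x \<in> (\<lambda>z. A *v z + A *v s) ` cbox (- 1) 1" by blast
  next
    fix x assume "x \<in> (\<lambda>z. A *v z + A *v s) ` cbox (- 1) 1"
    then obtain z where z: "z \<in> cbox (- 1) 1" "x = A *v z + A *v s" by auto
    then have "M *v x - s = z" by (simp add: MA matrix_vector_right_distrib)
    then show "x \<in> C" using z C_iff by simp
  qed
  moreover have "invertible A" using A by (auto simp: invertible_def)
  ultimately show ?thesis by (auto simp: parallelotope_def)
qed

section \<open>The gauge is an intersection of slabs\<close>

text \<open>
  Along a direction orthogonal to all touching normals no separating half-space could stop a line,
  so \<open>C\<close> would be unbounded.
\<close>

lemma touching_normals_span: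
  fixes C :: "(real ^ 'n) set"
  assumes C: "convex_body C" and r: "0 < r" "cball c r \<subseteq> C"
  shows "span {u. \<exists>q. touching_ball C q u} = UNIV"
proof (rule ccontr)
  let ?N = "{u. \<exists>q. touching_ball C q u}"
  have cv: "convex C" and cC: "compact C" using C by (auto simp: convex_body_def)
  assume "span ?N \<noteq> UNIV"
  then have "span ?N \<subset> span UNIV" by auto
  then obtain w where w: "w \<noteq> 0" "\<And>y. y \<in> span ?N \<Longrightarrow> orthogonal w y"
    using orthogonal_to_subspace_exists_gen by metis
  have cC': "c \<in> C" using r by auto
  have line: "c + k *\<^sub>R w \<in> C" for k
  proof (rule ccontr)
    assume "c + k *\<^sub>R w \<notin> C"
    then obtain q u where qu: "touching_ball C q u" "u \<bullet> (q + u) < u \<bullet> (c + k *\<^sub>R w)"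
      using touching_ball_separates[OF cv compact_imp_closed[OF cC] r] by blast
    have "u \<in> span ?N" using qu(1) by (intro span_base) auto
    then have "u \<bullet> w = 0" using w(2) by (simp add: orthogonal_def inner_commute)
    then have "u \<bullet> (q + u) < u \<bullet> c" using qu(2) by (simp add: inner_add_right)
    then show False using qu(1) cC' by (auto simp: touching_ball_def not_le[symmetric])
  qed
  obtain b where b: "\<And>x. x \<in> C \<Longrightarrow> norm x \<le> b"
    using compact_imp_bounded[OF cC] by (auto simp: bounded_iff)
  \<comment> \<open>Chosen so that \<open>c + k w\<close> has norm at least \<open>b + 1\<close>.\<close>
  define k where "k = (norm c + b + 1) / norm w"
  have "0 \<le> b" using b[OF cC'] norm_ge_zero[of c] by linarith
  then have "norm (k *\<^sub>R w) = norm c + b + 1" using w(1) by (simp add: k_def)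
  moreover have "norm (k *\<^sub>R w) \<le> norm (c + k *\<^sub>R w) + norm c"
    using norm_triangle_ineq4[of "c + k *\<^sub>R w" c] by simp
  ultimately show False using b[OF line[of k]] by simp
qed

text \<open>
  The differences of \<open>- C\<close> are the differences of \<open>C\<close>, so \<open>- C\<close> fits into a translate of \<open>C\<close>.
  Applying this inclusion twice shows that it is an equality.
\<close>

lemma reflection_is_translate:
  fixes C :: "(real ^ 'n) set"
  assumes "convex_body C"
    and helly: "\<And>K. convex_body K \<Longrightarrow>
        (\<And>x y. x \<in> K \<Longrightarrow> y \<in> K \<Longrightarrow> \<exists>a\<in>C. \<exists>b\<in>C. x - y = a - b) \<Longrightarrow> \<exists>t. \<forall>x\<in>K. t + x \<in> C"
  obtains t where "\<And>x. x \<in> C \<longleftrightarrow> t - x \<in> C"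
proof -
  have "convex_body (uminus ` C)"
    using assms(1) by (auto simp: convex_body_def convex_negations compact_negations)
  moreover have "\<exists>a\<in>C. \<exists>b\<in>C. x - y = a - b" if xy: "x \<in> uminus ` C" "y \<in> uminus ` C" for x y
  proof -
    obtain x' y' where "x' \<in> C" "x = - x'" "y' \<in> C" "y = - y'" using xy by blast
    then show ?thesis by (intro bexI[of _ y'] bexI[of _ x']) auto
  qed
  ultimately obtain t where t: "\<forall>x\<in>uminus ` C. t + x \<in> C" using helly by blast
  then have to: "t - x \<in> C" if "x \<in> C" for x using that by auto
  have "x \<in> C" if "t - x \<in> C" for x using to[OF that] by simp
  with to show thesis using that by blast
qed

text \<open>
  \<open>C\<close> is the intersection of the half-spaces at contact points. All their normals are
  multiples of finitely many basis elements, and by central symmetry every basis element occurs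
  with both signs, so the half-spaces group into one slab for each basis element.
\<close>

lemma parallelotope_if_helly:
  fixes C :: "(real ^ 'n) set"
  assumes C: "convex_body C" and fd: "full_dimensional C"
    and helly: "\<And>K. convex_body K \<Longrightarrow>
        (\<And>x y. x \<in> K \<Longrightarrow> y \<in> K \<Longrightarrow> \<exists>a\<in>C. \<exists>b\<in>C. x - y = a - b) \<Longrightarrow> \<exists>t. \<forall>x\<in>K. t + x \<in> C"
  shows "parallelotope C"
proof -
  have cv: "convex C" and cC: "compact C" using C by (auto simp: convex_body_def)
  obtain c r where r: "0 < r" "cball c r \<subseteq> C"
    using full_dimensional_interior[OF C fd] by blast
  obtain t where t: "\<And>x. x \<in> C \<longleftrightarrow> t - x \<in> C"
    using reflection_is_translate[OF C helly] by blast
  have sym: "touching_ball C (t - q) (- u)" if qu: "touching_ball C q u" for q u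
  proof -
    have "t - z \<in> cball q (norm u)" if "z \<in> cball (t - q) (norm u)" for z
    proof -
      have "q - (t - z) = - ((t - q) - z)" by simp
      then show ?thesis using that by (simp only: mem_cball dist_norm norm_minus_cancel)
    qed
    then have "cball (t - q) (norm u) \<subseteq> C"
      using qu t unfolding touching_ball_def by blast
    moreover have "- u \<bullet> z \<le> - u \<bullet> (t - q + - u)" if "z \<in> C" for z
    proof -
      have "u \<bullet> (t - z) \<le> u \<bullet> (q + u)" using qu t that by (auto simp: touching_ball_def)
      then show ?thesis by (simp add: inner_diff_right inner_add_right)
    qed
    ultimately show ?thesis using qu by (simp add: touching_ball_def)
  qed
  obtain B where B: "B \<subseteq> {u. \<exists>q. touching_ball C q u}" "independent B"
    "{u. \<exists>q. touching_ball C q u} \<subseteq> span B"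
    using maximal_independent_subset by blast
  have spanB: "span B = UNIV"
    using span_mono[OF B(3)] touching_normals_span[OF C r] by (auto simp: span_span)
  define p where "p b = (SOME q. touching_ball C q b)" for b
  have p: "touching_ball C (p b) b" if "b \<in> B" for b
    using B(1) that someI_ex[of "\<lambda>q. touching_ball C q b"] by (auto simp: p_def)
  have inC: "q + s *\<^sub>R u \<in> C" if "touching_ball C q u" "\<bar>s\<bar> \<le> 1" for q u s
  proof -
    have "q + s *\<^sub>R u \<in> cball q (norm u)"
      using that(2) by (simp add: dist_norm mult_left_le_one_le)
    then show ?thesis using that(1) by (auto simp: touching_ball_def)
  qed
  define hi where "hi b = b \<bullet> (p b + b)" for b
  define lo where "lo b = b \<bullet> (t - (p b + b))" for b
  have support: "lo b \<le> b \<bullet> x \<and> b \<bullet> x \<le> hi b" if "b \<in> B" "x \<in> C" for b x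
  proof -
    have "b \<bullet> (t - x) \<le> hi b" "b \<bullet> x \<le> hi b"
      using p[OF that(1)] that(2) t by (auto simp: touching_ball_def hi_def)
    then show ?thesis by (simp add: hi_def lo_def inner_diff_right)
  qed
  have "lo b < hi b" if b: "b \<in> B" for b
  proof -
    have "lo b \<le> b \<bullet> p b"
      using support[OF b] inC[OF p[OF b], of 0] by simp
    moreover have "0 < b \<bullet> b" using p[OF b] by (simp add: touching_ball_def)
    ultimately show ?thesis unfolding hi_def inner_add_right by linarith
  qed
  moreover have "x \<in> C \<longleftrightarrow> (\<forall>b\<in>B. lo b \<le> b \<bullet> x \<and> b \<bullet> x \<le> hi b)" for x
  proof
    assume "x \<in> C"
    then show "\<forall>b\<in>B. lo b \<le> b \<bullet> x \<and> b \<bullet> x \<le> hi b" using support by blast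
  next
    assume x: "\<forall>b\<in>B. lo b \<le> b \<bullet> x \<and> b \<bullet> x \<le> hi b"
    show "x \<in> C"
    proof (rule ccontr)
      assume "x \<notin> C"
      then obtain q u where qu: "touching_ball C q u" "u \<bullet> (q + u) < u \<bullet> x"
        using touching_ball_separates[OF cv compact_imp_closed[OF cC] r] by blast
      obtain b k where b: "b \<in> B" and k: "u = k *\<^sub>R b"
        using touching_normals_multiples_of_basis[OF cv helly _ B(2) spanB _ qu(1)] sym p by blast
      have "p b + b \<in> C" using inC[OF p[OF b], of 1] by simp
      then have "p b + b \<in> C" "t - (p b + b) \<in> C" using t by blast+
      then have "u \<bullet> (p b + b) \<le> u \<bullet> (q + u)" "u \<bullet> (t - (p b + b)) \<le> u \<bullet> (q + u)"
        using qu(1) by (auto simp only: touching_ball_def)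
      then have "k * hi b < k * (b \<bullet> x)" "k * lo b < k * (b \<bullet> x)"
        using qu(2) unfolding k hi_def lo_def inner_scaleR_left by linarith+
      moreover have "lo b \<le> b \<bullet> x" "b \<bullet> x \<le> hi b" using x b by auto
      ultimately show False
        by (cases "0 \<le> k") (auto simp: mult_less_cancel_left)
    qed
  qed
  ultimately show ?thesis using parallelotope_if_slabs[OF B(2) spanB, of lo hi C] by blast
qed

theorem theorem1p5:
  fixes C :: "(real ^ 'n) set"
  assumes "CARD('n) \<ge> 2"
    and "convex_body C" and "full_dimensional C"
  shows "convex hull {(0, 1), (1, 1)} \<subseteq> radii_diagram C \<and>
    (convex hull {(0, 1), (1, 1)} = radii_diagram C \<longleftrightarrow> parallelotope C)"
proof -
  have sub: "{0..1} \<times> {1} \<subseteq> radii_diagram C"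
    using segment_point_realized[OF assms] by auto
  have "parallelotope C" if "radii_diagram C \<subseteq> {0..1} \<times> {1}"
    using parallelotope_if_helly[OF assms(2,3)] translate_into_gauge[OF assms(2,3) that] by blast
  then show ?thesis
    using sub diagram_of_parallelotope[OF _ assms(2,3)] unfolding unit_segment_hull by blast
qed

end
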